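(* Let $\mathcal{G}$ be any Stackelberg game and $\mathcal{H} \subseteq [K]^{\mathcal{Z}}$ any nonempty hypothesis class. For every $\epsilon > 0$ and every deterministic online algorithm for the leader, there exist $T$ and a sequence of contexts and follower types $(\mathbf{z}_1, f_1), \ldots, (\mathbf{z}_T, f_T)$ that is realizable by $\mathcal{H}$ and on which the algorithm suffers regret $$R(T) \ge \mathrm{SLdim}_{\mathcal{G}}(\mathcal{H}) - \epsilon,$$ where, if $\mathrm{SLdim}_{\mathcal{G}}(\mathcal{H}) = \infty$, this means that for every $\kappa \geq 0$ there are $T$ and a realizable sequence with $R(T) \geq \kappa$.
   Context: Stackelberg game. A (contextual) Stackelberg game is a tuple $\mathcal{G} = (\mathcal{A}, \mathcal{A}_f, \mathcal{Z}, u, u_{f^{(1)}}, \ldots, u_{f^{(K)}})$, where $\mathcal{A}$ and $\mathcal{A}_f$ are the finite nonempty action sets of the leader and the follower, $\mathcal{Z} \subseteq \mathbb{R}^d$ is the set of contexts, $u : \mathcal{Z} \times \mathcal{A} \times \mathcal{A}_f \to [0,1]$ is the leader's utility, and $u_{f^{(i)}} : \mathcal{Z} \times \mathcal{A} \times \mathcal{A}_f \to [0,1]$ is the utility of a follower of type $f^{(i)}$, $i \in [K] = \{1,\ldots,K\}$. $\Delta(\mathcal{A})$ is the probability simplex over $\mathcal{A}$ (leader mixed strategies), and $u(\mathbf{z}, \mathbf{x}, a_f) := \sum_{a_l \in \mathcal{A}} \mathbf{x}[a_l]\, u(\mathbf{z}, a_l, a_f)$ for $\mathbf{x} \in \Delta(\mathcal{A})$.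 The best response of type $f^{(i)}$ is $b_{f^{(i)}}(\mathbf{z}, \mathbf{x}) \in \arg\max_{a_f \in \mathcal{A}_f} \sum_{a_l} \mathbf{x}[a_l]\, u_{f^{(i)}}(\mathbf{z}, a_l, a_f)$, ties being broken by a fixed, known, deterministic order on $\mathcal{A}_f$. The leader's loss is $r(\mathbf{z}, \mathbf{x}, f^{(i)}) := \sup_{\mathbf{x}' \in \Delta(\mathcal{A})} u(\mathbf{z}, \mathbf{x}', b_{f^{(i)}}(\mathbf{z}, \mathbf{x}')) - u(\mathbf{z}, \mathbf{x}, b_{f^{(i)}}(\mathbf{z}, \mathbf{x}))$. Online protocol. The leader knows $\mathcal{G}$ and $\mathcal{H}$. In each round $t = 1, \ldots, T$, a context $\mathbf{z}_t \in \mathcal{Z}$ is revealed, the leader commits to $\mathbf{x}_t \in \Delta(\mathcal{A})$, and then the follower's type $f_t$ is revealed. A deterministic algorithm chooses $\mathbf{x}_t$ as a function of $\mathbf{z}_1, f_1, \ldots, \mathbf{z}_{t-1}, f_{t-1}, \mathbf{z}_t$. The regret is $R(T) = \sum_{t=1}^T r(\mathbf{z}_t, \mathbf{x}_t, f_t)$. A sequence is realizable by $\mathcal{H}$ if there is $h^* \in \mathcal{H}$ with $f_t = f^{(h^*(\mathbf{z}_t))}$ for all $t$. Stackelberg Littlestone (SL) tree. A finite-depth rooted tree in which each internal node is labeled with an element of $\mathcal{Z}$ and each edge corresponds to a label in $[K]$ (distinct edges leaving the same node have distinct labels). Nodes are indexed by the sequence $s$ of edge labels on the path from the root (the root is $\varnothing$),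 and $\mathbf{z}_s$ is the context at node $s$. Each node $s$ has a weight $\rho_s$: $\rho_s = 0$ if $s$ is a leaf, and otherwise $$\rho_s = \inf_{\mathbf{x} \in \Delta(\mathcal{A})} \max_{j \in [K]:\, sj \text{ is a child of } s} \left( r(\mathbf{z}_s, \mathbf{x}, f^{(j)}) + \rho_{sj} \right).$$ The tree is shattered by $\mathcal{H}$ under $\mathcal{G}$ if for every root-to-leaf path there is $h \in \mathcal{H}$ such that, for every internal node $\mathbf{z}$ on the path, the label of the edge of the path leaving $\mathbf{z}$ is $h(\mathbf{z})$. SL dimension. $\mathrm{SLdim}_{\mathcal{G}}(\mathcal{H}) := \sup\{\kappa \ge 0 : \text{there exists an SL tree shattered by } \mathcal{H} \text{ under } \mathcal{G} \text{ with root node weight } \kappa\}$, which equals $\infty$ if for every $\kappa \geq 0$ there is a shattered SL tree with root weight at least $\kappa$. *)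

theory Defs
  imports "HOL-Analysis.Analysis"
begin

section \<open>Contextual Stackelberg games\<close>

text \<open>
  Follower types \<open>f\<^sup>(\<^sup>1\<^sup>), \<dots>, f\<^sup>(\<^sup>K\<^sup>)\<close> are identified with their indices in \<open>{1..K}\<close>.
  \<open>tie_order\<close> is the order on the follower's actions used to break ties: among several
  utility-maximizing actions the follower plays the least one.
\<close>

record ('a, 'b, 'd :: finite) game =
  leader_actions :: "'a set"
  follower_actions :: "'b set"
  contexts :: "(real ^ 'd) set"
  num_types :: nat
  leader_utility :: "real ^ 'd \<Rightarrow> 'a \<Rightarrow> 'b \<Rightarrow> real"
  follower_utility :: "nat \<Rightarrow> real ^ 'd \<Rightarrow> 'a \<Rightarrow> 'b \<Rightarrow> real"
  tie_order :: "('b \<times> 'b) set"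

definition types :: "('a, 'b, 'd :: finite) game \<Rightarrow> nat set" where
  "types G = {1..num_types G}"

locale stackelberg_game =
  fixes G :: "('a, 'b, 'd :: finite) game"
  assumes finite_leader: "finite (leader_actions G)"
    and nonempty_leader: "leader_actions G \<noteq> {}"
    and finite_follower: "finite (follower_actions G)"
    and nonempty_follower: "follower_actions G \<noteq> {}"
    and leader_utility_range:
      "\<And>z a b. \<lbrakk>z \<in> contexts G; a \<in> leader_actions G; b \<in> follower_actions G\<rbrakk>
        \<Longrightarrow> leader_utility G z a b \<in> {0..1}"
    and follower_utility_range:
      "\<And>i z a b. \<lbrakk>i \<in> types G; z \<in> contexts G; a \<in> leader_actions G; b \<in> follower_actions G\<rbrakk>
        \<Longrightarrow> follower_utility G i z a b \<in> {0..1}"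
    and tie_order: "linear_order_on (follower_actions G) (tie_order G)"

text \<open>
  A mixed strategy is a function on the whole type, normalized to \<open>0\<close> off the action set.
\<close>

definition mixed_strategies :: "('a, 'b, 'd :: finite) game \<Rightarrow> ('a \<Rightarrow> real) set" where
  "mixed_strategies G =
    {x. (\<forall>a \<in> leader_actions G. 0 \<le> x a) \<and> (\<forall>a. a \<notin> leader_actions G \<longrightarrow> x a = 0) \<and>
        (\<Sum>a\<in>leader_actions G. x a) = 1}"

definition leader_payoff ::
    "('a, 'b, 'd :: finite) game \<Rightarrow> real ^ 'd \<Rightarrow> ('a \<Rightarrow> real) \<Rightarrow> 'b \<Rightarrow> real" where
  "leader_payoff G z x b = (\<Sum>a\<in>leader_actions G. x a * leader_utility G z a b)"

definition follower_payoff ::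
    "('a, 'b, 'd :: finite) game \<Rightarrow> nat \<Rightarrow> real ^ 'd \<Rightarrow> ('a \<Rightarrow> real) \<Rightarrow> 'b \<Rightarrow> real" where
  "follower_payoff G i z x b = (\<Sum>a\<in>leader_actions G. x a * follower_utility G i z a b)"

definition best_responses ::
    "('a, 'b, 'd :: finite) game \<Rightarrow> nat \<Rightarrow> real ^ 'd \<Rightarrow> ('a \<Rightarrow> real) \<Rightarrow> 'b set" where
  "best_responses G i z x =
    {b. is_arg_max (follower_payoff G i z x) (\<lambda>b. b \<in> follower_actions G) b}"

definition best_response ::
    "('a, 'b, 'd :: finite) game \<Rightarrow> nat \<Rightarrow> real ^ 'd \<Rightarrow> ('a \<Rightarrow> real) \<Rightarrow> 'b" where
  "best_response G i z x =
    (THE b. b \<in> best_responses G i z x \<and> (\<forall>b' \<in> best_responses G i z x. (b, b') \<in> tie_order G))"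

definition loss ::
    "('a, 'b, 'd :: finite) game \<Rightarrow> real ^ 'd \<Rightarrow> ('a \<Rightarrow> real) \<Rightarrow> nat \<Rightarrow> real" where
  "loss G z x i =
    (SUP x'\<in>mixed_strategies G. leader_payoff G z x' (best_response G i z x'))
      - leader_payoff G z x (best_response G i z x)"

section \<open>Online protocol\<close>

text \<open>
  An algorithm maps the history \<open>[(z\<^sub>1, f\<^sub>1), \<dots>, (z\<^sub>t\<^sub>-\<^sub>1, f\<^sub>t\<^sub>-\<^sub>1)]\<close> and the current context \<open>z\<^sub>t\<close>
  to a mixed strategy.
\<close>

type_synonym ('a, 'd) algorithm = "((real ^ 'd) \<times> nat) list \<Rightarrow> real ^ 'd \<Rightarrow> 'a \<Rightarrow> real"

definition online_algorithm ::
    "('a, 'b, 'd :: finite) game \<Rightarrow> ('a, 'd) algorithm \<Rightarrow> bool" where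
  "online_algorithm G alg \<longleftrightarrow>
    (\<forall>hist z. set hist \<subseteq> contexts G \<times> types G \<longrightarrow> z \<in> contexts G \<longrightarrow>
      alg hist z \<in> mixed_strategies G)"

definition regret ::
    "('a, 'b, 'd :: finite) game \<Rightarrow> ('a, 'd) algorithm \<Rightarrow> ((real ^ 'd) \<times> nat) list \<Rightarrow> real" where
  "regret G alg \<sigma> =
    (\<Sum>t<length \<sigma>. loss G (fst (\<sigma> ! t)) (alg (take t \<sigma>) (fst (\<sigma> ! t))) (snd (\<sigma> ! t)))"

definition realizable :: "('z \<Rightarrow> nat) set \<Rightarrow> ('z \<times> nat) list \<Rightarrow> bool" where
  "realizable H \<sigma> \<longleftrightarrow> (\<exists>h \<in> H. \<forall>(z, f) \<in> set \<sigma>. f = h z)"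

section \<open>Stackelberg Littlestone trees\<close>

text \<open>
  In \<open>Node z c\<close> the outgoing edges are the labels in \<open>dom c\<close>, and \<open>c j = Some t\<close> means that the
  edge labelled \<open>j\<close> leads to the subtree \<open>t\<close>; that distinct edges carry distinct labels is thus
  built in. Trees in this datatype are well-founded, so those whose labels all lie in the finite
  set \<open>types G\<close> are exactly the ones of finite depth.
\<close>

datatype 'z tree = Leaf | Node 'z "nat \<rightharpoonup> 'z tree"

inductive SL_tree :: "('a, 'b, 'd :: finite) game \<Rightarrow> (real ^ 'd) tree \<Rightarrow> bool"
  for G :: "('a, 'b, 'd) game" where
  Leaf: "SL_tree G Leaf"
| Node: "\<lbrakk>z \<in> contexts G; dom c \<noteq> {}; dom c \<subseteq> types G; \<And>j t. c j = Some t \<Longrightarrow> SL_tree G t\<rbrakk>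
    \<Longrightarrow> SL_tree G (Node z c)"

primrec weight :: "('a, 'b, 'd :: finite) game \<Rightarrow> (real ^ 'd) tree \<Rightarrow> real" where
  "weight G Leaf = 0"
| "weight G (Node z c) =
    (INF x\<in>mixed_strategies G. MAX j\<in>dom c. loss G z x j + the (map_option (weight G) (c j)))"

text \<open>
  The option map in the definition only serves the recursion; the defining equation reads as
  follows.
\<close>

lemma weight_Node:
  "weight G (Node z c) =
    (INF x\<in>mixed_strategies G. MAX j\<in>dom c. loss G z x j + weight G (the (c j)))"
proof -
  have "(\<lambda>j. loss G z x j + the (map_option (weight G) (c j))) ` dom c =
        (\<lambda>j. loss G z x j + weight G (the (c j))) ` dom c" for x
    by (rule image_cong) (auto simp: option.map_sel)
  then show ?thesis by simp
qed

text \<open>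
  Root-to-leaf paths, as the list of (context of internal node, label of the edge leaving it).
\<close>

inductive root_leaf_path :: "'z tree \<Rightarrow> ('z \<times> nat) list \<Rightarrow> bool" where
  Leaf: "root_leaf_path Leaf []"
| Node: "\<lbrakk>c j = Some t; root_leaf_path t p\<rbrakk> \<Longrightarrow> root_leaf_path (Node z c) ((z, j) # p)"

definition shattered :: "('z \<Rightarrow> nat) set \<Rightarrow> 'z tree \<Rightarrow> bool" where
  "shattered H t \<longleftrightarrow> (\<forall>p. root_leaf_path t p \<longrightarrow> (\<exists>h \<in> H. \<forall>(z, j) \<in> set p. j = h z))"

definition SLdim ::
    "('a, 'b, 'd :: finite) game \<Rightarrow> (real ^ 'd \<Rightarrow> nat) set \<Rightarrow> ereal" where
  "SLdim G H = Sup {ereal \<kappa> | \<kappa>. 0 \<le> \<kappa> \<and> (\<exists>t. SL_tree G t \<and> shattered H t \<and> weight G t = \<kappa>)}"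

end

theory Submission
  imports Defs
begin

text \<open>
  The adversary walks down a shattered tree of weight close to \<open>SLdim G H\<close>: at a node with context
  \<open>z\<close> and weight \<open>\<rho>\<close> the algorithm commits to some \<open>x\<close>, and since \<open>\<rho>\<close> is an infimum over mixed
  strategies, some child \<open>j\<close> satisfies \<open>\<rho> \<le> loss G z x j + \<rho>\<^sub>j\<close>. Revealing the type \<open>j\<close> and moving to
  that child, the regret along the resulting path telescopes to at least the weight of the root,
  and shattering makes the path realizable.
\<close>

text \<open>Serves tie-breaking: applied to the set of maximizers, it yields the action the follower
  plays.\<close>

lemma linear_order_on_finite_least:
  assumes "linear_order_on A r" "finite S" "S \<noteq> {}" "S \<subseteq> A"
  shows "\<exists>b\<in>S. \<forall>b'\<in>S. (b, b') \<in> r"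
  using assms(2-4)
proof (induction rule: finite_ne_induct)
  case (singleton x)
  then show ?case
    using assms(1) by (auto simp: order_on_defs refl_on_def)
next
  case (insert x F)
  then obtain b where b: "b \<in> F" "\<forall>b'\<in>F. (b, b') \<in> r"
    by auto
  have refl: "(x, x) \<in> r" and trans: "trans r" and total: "(x, b) \<in> r \<or> (b, x) \<in> r"
    using assms(1) insert b by (auto simp: order_on_defs refl_on_def total_on_def)
  show ?case
    using total
  proof
    assume "(x, b) \<in> r"
    then show ?thesis
      using b refl trans by (auto dest: transD)
  next
    assume "(b, x) \<in> r"
    then show ?thesis
      using b by auto
  qed
qed

context stackelberg_game
begin

text \<open>\<open>best_response\<close> is a definite description, so its value is known only once
  the described action exists and is unique. Finiteness gives a maximizer and then a least one in
  \<open>tie_order G\<close>; antisymmetry gives uniqueness.\<close>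

lemma best_response_in_follower_actions: "best_response G i z x \<in> follower_actions G"
proof -
  let ?S = "best_responses G i z x" and ?f = "follower_payoff G i z x"
  have sub: "?S \<subseteq> follower_actions G"
    by (auto simp: best_responses_def is_arg_max_def)
  have "Max (?f ` follower_actions G) \<in> ?f ` follower_actions G"
    using finite_follower nonempty_follower by (intro Max_in) auto
  then obtain b where "b \<in> follower_actions G" "?f b = Max (?f ` follower_actions G)"
    by auto
  then have "b \<in> ?S"
    using finite_follower
    by (auto simp: best_responses_def is_arg_max_def not_less)
  then obtain m where m: "m \<in> ?S" "\<forall>b'\<in>?S. (m, b') \<in> tie_order G"
    using linear_order_on_finite_least[OF tie_order finite_subset[OF sub finite_follower] _ sub]
    by blast
  have "best_response G i z x = m"
    unfolding best_response_def
    using m tie_order by (intro the_equality) (auto simp: order_on_defs dest: antisymD)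
  then show ?thesis
    using m sub by auto
qed

lemma leader_payoff_le_1:
  assumes "z \<in> contexts G" "x \<in> mixed_strategies G" "b \<in> follower_actions G"
  shows "leader_payoff G z x b \<le> 1"
proof -
  have "leader_payoff G z x b \<le> (\<Sum>a\<in>leader_actions G. x a)"
    unfolding leader_payoff_def
    using assms leader_utility_range
    by (intro sum_mono mult_left_le) (auto simp: mixed_strategies_def)
  then show ?thesis
    using assms by (simp add: mixed_strategies_def)
qed

text \<open>In \<open>loss\<close> only the subtracted payoff varies with \<open>x\<close>, and it
  is at most 1. The supremum is a constant, so its actual value does not matter for the
  bound.\<close>

lemma bdd_below_loss:
  assumes "z \<in> contexts G"
  shows "bdd_below ((\<lambda>x. loss G z x i) ` mixed_strategies G)"
proof (rule bdd_belowI2)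
  fix x assume "x \<in> mixed_strategies G"
  then show "(SUP x'\<in>mixed_strategies G. leader_payoff G z x' (best_response G i z x')) - 1
      \<le> loss G z x i"
    using leader_payoff_le_1[OF assms _ best_response_in_follower_actions]
    by (simp add: loss_def)
qed

text \<open>The adversary's move against \<open>x\<close>: the infimum is at most the maximum at
  \<open>x\<close>, and that maximum over the finite nonempty set \<open>dom c\<close> is attained
  by some child.\<close>

lemma weight_le_child:
  assumes "z \<in> contexts G" "dom c \<noteq> {}" "dom c \<subseteq> types G" "x \<in> mixed_strategies G"
  obtains j where "j \<in> dom c" "weight G (Node z c) \<le> loss G z x j + weight G (the (c j))"
proof -
  define M where "M y = (MAX j\<in>dom c. loss G z y j + weight G (the (c j)))" for y
  have fin: "finite (dom c)"
    using assms(3) by (rule finite_subset) (simp add: types_def)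
  obtain i where i: "i \<in> dom c"
    using assms(2) by auto
  obtain B where B: "B \<le> loss G z y i" if "y \<in> mixed_strategies G" for y
    using bdd_below_loss[OF assms(1), of i] by (auto simp: bdd_below_def)
  \<comment> \<open>An infimum of reals is a lower bound only for sets bounded below. One fixed
    child \<open>i\<close> suffices here, since \<open>M y\<close> dominates its term.\<close>
  have "bdd_below (M ` mixed_strategies G)"
  proof (rule bdd_belowI2)
    fix y assume "y \<in> mixed_strategies G"
    then have "B + weight G (the (c i)) \<le> loss G z y i + weight G (the (c i))"
      using B by simp
    also have "\<dots> \<le> M y"
      unfolding M_def using fin i by (intro Max_ge) auto
    finally show "B + weight G (the (c i)) \<le> M y" .
  qed
  then have "weight G (Node z c) \<le> M x"
    unfolding weight_Node M_def[symmetric] using assms(4) by (rule cINF_lower)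
  moreover have "M x \<in> (\<lambda>j. loss G z x j + weight G (the (c j))) ` dom c"
    unfolding M_def using fin assms(2) by (intro Max_in) auto
  ultimately show thesis
    using that by (metis (no_types, lifting) imageE)
qed

end

text \<open>Prefixing the first round to every later history turns the rest of the play into a fresh
  game against a modified algorithm.\<close>

lemma regret_Cons:
  "regret G alg ((z, j) # p) = loss G z (alg [] z) j + regret G (\<lambda>hist. alg ((z, j) # hist)) p"
  unfolding regret_def by (simp add: sum.lessThan_Suc_shift del: sum.lessThan_Suc)

lemma online_algorithm_Cons:
  assumes "online_algorithm G alg" "z \<in> contexts G" "j \<in> types G"
  shows "online_algorithm G (\<lambda>hist. alg ((z, j) # hist))"
  using assms by (simp add: online_algorithm_def)

lemma (in stackelberg_game) path_with_regret_ge_weight: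
  assumes "SL_tree G t" "online_algorithm G alg"
  shows "\<exists>p. root_leaf_path t p \<and> set p \<subseteq> contexts G \<times> types G \<and> weight G t \<le> regret G alg p"
  using assms
\<comment> \<open>The algorithm is generalized because below the root the play is against the one
  that has already seen \<open>(z, j)\<close>.\<close>
proof (induction arbitrary: alg rule: SL_tree.induct)
  case Leaf
  have "root_leaf_path Leaf []"
    by (rule root_leaf_path.Leaf)
  moreover have "regret G alg [] = 0"
    by (simp add: regret_def)
  ultimately show ?case
    by (intro exI[of _ "[]"]) simp
next
  case (Node z c)
  have "alg [] z \<in> mixed_strategies G"
    using Node by (simp add: online_algorithm_def)
  then obtain j where j: "j \<in> dom c"
      "weight G (Node z c) \<le> loss G z (alg [] z) j + weight G (the (c j))"
    using weight_le_child Node.hyps by metis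
  then obtain t where t: "c j = Some t"
    by auto
  have jt: "j \<in> types G"
    using Node.hyps j by auto
  obtain p where p: "root_leaf_path t p" "set p \<subseteq> contexts G \<times> types G"
      "weight G t \<le> regret G (\<lambda>hist. alg ((z, j) # hist)) p"
    using Node.IH[OF t online_algorithm_Cons[OF Node.prems Node.hyps(1) jt]] by blast
  have "root_leaf_path (Node z c) ((z, j) # p)"
    using t p(1) by (rule root_leaf_path.Node)
  moreover have "weight G (Node z c) \<le> regret G alg ((z, j) # p)"
    using j(2) t p(3) by (simp add: regret_Cons del: weight.simps)
  ultimately show ?case
    using p(2) jt Node.hyps(1) by (intro exI[of _ "(z, j) # p"]) auto
qed

text \<open>The supremum need not be attained, but any \<open>c\<close> strictly below it is
  exceeded by the weight of a shattered tree. This form covers finite and infinite dimension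
  alike.\<close>

lemma (in stackelberg_game) realizable_regret_gt:
  assumes "online_algorithm G alg" "ereal c < SLdim G H"
  shows "\<exists>\<sigma>. set \<sigma> \<subseteq> contexts G \<times> types G \<and> realizable H \<sigma> \<and> c < regret G alg \<sigma>"
proof -
  obtain t where t: "SL_tree G t" "shattered H t" "c < weight G t"
    using assms(2) by (auto simp: SLdim_def less_Sup_iff)
  obtain p where "root_leaf_path t p" "set p \<subseteq> contexts G \<times> types G" "weight G t \<le> regret G alg p"
    using path_with_regret_ge_weight[OF t(1) assms(1)] by blast
  then show ?thesis
    using t by (intro exI[of _ p]) (auto simp: shattered_def realizable_def)
qed

text \<open>Any member of \<open>H\<close> shatters the one-leaf tree, whose only path is empty.
  This rules out a supremum over the empty set, so a dimension below infinity is a real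
  number.\<close>

lemma SLdim_nonneg:
  assumes "H \<noteq> {}"
  shows "0 \<le> SLdim G H"
proof -
  have "shattered H Leaf"
    using assms by (auto simp: shattered_def elim: root_leaf_path.cases)
  then have "ereal 0 \<in> {ereal \<kappa> | \<kappa>. 0 \<le> \<kappa> \<and>
      (\<exists>t. SL_tree G t \<and> shattered H t \<and> weight G t = \<kappa>)}"
    using SL_tree.Leaf[of G] by force
  then show ?thesis
    unfolding SLdim_def by (simp add: Sup_upper zero_ereal_def)
qed

theorem theorem3p8:
  fixes G :: "('a, 'b, 'd :: finite) game"
    and H :: "(real ^ 'd \<Rightarrow> nat) set"
    and alg :: "('a, 'd) algorithm"
    and \<epsilon> :: real
  assumes "stackelberg_game G"
    and "H \<subseteq> contexts G \<rightarrow>\<^sub>E types G"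
    and "H \<noteq> {}"
    and "\<epsilon> > 0"
    and "online_algorithm G alg"
  shows "(SLdim G H < \<infinity> \<longrightarrow>
            (\<exists>T \<sigma>. length \<sigma> = T \<and> set \<sigma> \<subseteq> contexts G \<times> types G \<and> realizable H \<sigma> \<and>
              ereal (regret G alg \<sigma>) \<ge> SLdim G H - ereal \<epsilon>)) \<and>
         (SLdim G H = \<infinity> \<longrightarrow>
            (\<forall>\<kappa>::real. \<kappa> \<ge> 0 \<longrightarrow>
              (\<exists>T \<sigma>. length \<sigma> = T \<and> set \<sigma> \<subseteq> contexts G \<times> types G \<and> realizable H \<sigma> \<and>
                regret G alg \<sigma> \<ge> \<kappa>)))"
proof -
  interpret stackelberg_game G
    by (rule assms(1))
  note ex = realizable_regret_gt[OF assms(5)]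
  show ?thesis
  proof (intro conjI impI allI)
    assume "SLdim G H < \<infinity>"
    with SLdim_nonneg[OF assms(3), of G] obtain s where s: "SLdim G H = ereal s"
      by (cases "SLdim G H") auto
    then have "ereal (s - \<epsilon>) < SLdim G H"
      using assms(4) by simp
    from ex[OF this] show "\<exists>T \<sigma>. length \<sigma> = T \<and> set \<sigma> \<subseteq> contexts G \<times> types G \<and> realizable H \<sigma> \<and>
        ereal (regret G alg \<sigma>) \<ge> SLdim G H - ereal \<epsilon>"
      using s by force
  next
    fix \<kappa> :: real
    assume "SLdim G H = \<infinity>"
    then have "ereal \<kappa> < SLdim G H"
      by simp
    from ex[OF this] show "\<exists>T \<sigma>. length \<sigma> = T \<and> set \<sigma> \<subseteq> contexts G \<times> types G \<and> realizable H \<sigma> \<and>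
        regret G alg \<sigma> \<ge> \<kappa>"
      by force
  qed
qed

end
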